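(* Let $\mathsf{JL}$ be one of $\mathsf{J},\mathsf{J4},\mathsf{JD},\mathsf{JD4},\mathsf{JT},\mathsf{LP}$ and let $\mathsf{CS}$ be a constant specification for $\mathsf{JL}$. Then all labeled formulas in a derivation in $\mathsf{G3JL}_{\mathsf{CS}}$ are labeled-subformulas of labeled formulas in the endsequent.
   Context: Justification logics. Terms are built from justification variables and constants by binary $\cdot,+$ and, if (j4) is an axiom, unary $!$. Formulas are built from propositional variables and $\bot$ by $\neg,\wedge,\vee,\to$ and $t:A$. $\mathsf J$ has axiom schemes: propositional tautologies; $s:A\to(s+t):A$, $s:A\to(t+s):A$; $s:(A\to B)\to(t:A\to(s\cdot t):B)$. Further schemes: (jT) $t:A\to A$, (jD) $t:\bot\to\bot$, (j4) $t:A\to\,!t:t:A$. The names list the added schemes, $\mathsf{LP}=\mathsf{JT4}$. A constant specification $\mathsf{CS}$: if (j4) is not an axiom, a set of formulas $c_n:\dots:c_1:A$ ($n\ge1$, $c_j$ constants, $A$ an axiom instance), closed under passing from $c_n:c_{n-1}:\dots:c_1:A$ to $c_{n-1}:\dots:c_1:A$; if (j4) is an axiom, a set of formulas $c:A$ ($c$ a constant, $A$ an axiom instance). Calculus $\mathsf{G3JL}_{\mathsf{CS}}$. Fix a countably infinite set of labels $w,v,u,\dots$. The labeled language has labeled formulas $w\Vvdash A$, relational atoms $wRv$ and evidence atoms $wE(t,A)$ ($A$ a formula, $t$ a term). Sequents $\Gamma\Rightarrow\Delta$ consist of finite multisets of these. Initial sequents: $w\Vvdash P,\Gamma\Rightarrow\Delta,w\Vvdash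 P$ ($P$ a propositional variable); $w\Vvdash\bot,\Gamma\Rightarrow\Delta$; $wRv,\Gamma\Rightarrow\Delta,wRv$; $wE(t,A),\Gamma\Rightarrow\Delta,wE(t,A)$. Rules (premises / conclusion): (L$\neg$) $\Gamma\Rightarrow\Delta,w\Vvdash A$ / $w\Vvdash\neg A,\Gamma\Rightarrow\Delta$; (R$\neg$) $w\Vvdash A,\Gamma\Rightarrow\Delta$ / $\Gamma\Rightarrow\Delta,w\Vvdash\neg A$; (L$\wedge$) $w\Vvdash A,w\Vvdash B,\Gamma\Rightarrow\Delta$ / $w\Vvdash A\wedge B,\Gamma\Rightarrow\Delta$; (R$\wedge$) $\Gamma\Rightarrow\Delta,w\Vvdash A$ and $\Gamma\Rightarrow\Delta,w\Vvdash B$ / $\Gamma\Rightarrow\Delta,w\Vvdash A\wedge B$; (L$\vee$) $w\Vvdash A,\Gamma\Rightarrow\Delta$ and $w\Vvdash B,\Gamma\Rightarrow\Delta$ / $w\Vvdash A\vee B,\Gamma\Rightarrow\Delta$; (R$\vee$) $\Gamma\Rightarrow\Delta,w\Vvdash A,w\Vvdash B$ / $\Gamma\Rightarrow\Delta,w\Vvdash A\vee B$; (L$\to$) $\Gamma\Rightarrow\Delta,w\Vvdash A$ and $w\Vvdash B,\Gamma\Rightarrow\Delta$ / $w\Vvdash A\to B,\Gamma\Rightarrow\Delta$; (R$\to$) $w\Vvdash A,\Gamma\Rightarrow\Delta,w\Vvdash B$ / $\Gamma\Rightarrow\Delta,w\Vvdash A\to B$; (L:) $v\Vvdash A,w\Vvdash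 t:A,wRv,\Gamma\Rightarrow\Delta$ / $w\Vvdash t:A,wRv,\Gamma\Rightarrow\Delta$; (R:) $wRv,wE(t,A),\Gamma\Rightarrow\Delta,v\Vvdash A$ / $wE(t,A),\Gamma\Rightarrow\Delta,w\Vvdash t:A$, where the eigenlabel $v$ does not occur in the conclusion; (E) $wE(t,A),w\Vvdash t:A,\Gamma\Rightarrow\Delta$ / $w\Vvdash t:A,\Gamma\Rightarrow\Delta$; (El+) $wE(s+t,A),wE(t,A),\Gamma\Rightarrow\Delta$ / $wE(t,A),\Gamma\Rightarrow\Delta$; (Er+) $wE(t+s,A),wE(t,A),\Gamma\Rightarrow\Delta$ / $wE(t,A),\Gamma\Rightarrow\Delta$; (E$\cdot$) $wE(s\cdot t,B),wE(s,A\to B),wE(t,A),\Gamma\Rightarrow\Delta$ / $wE(s,A\to B),wE(t,A),\Gamma\Rightarrow\Delta$; (IAN)/(AN) $wE(c,F),\Gamma\Rightarrow\Delta$ / $\Gamma\Rightarrow\Delta$, for $c:F\in\mathsf{CS}$ ($c$ a constant). If (jT) is an axiom: (Ref) $wRw,\Gamma\Rightarrow\Delta$ / $\Gamma\Rightarrow\Delta$. If (jD) is an axiom: (Ser) $wRv,\Gamma\Rightarrow\Delta$ / $\Gamma\Rightarrow\Delta$, where the eigenlabel $v$ does not occur in the conclusion. If (j4) is an axiom: (E!) $wE(!t,t:A),wE(t,A),\Gamma\Rightarrow\Delta$ / $wE(t,A),\Gamma\Rightarrow\Delta$; (Mon) $vE(t,A),wE(t,A),wRv,\Gamma\Rightarrow\Delta$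 / $wE(t,A),wRv,\Gamma\Rightarrow\Delta$; (Trans) $wRu,wRv,vRu,\Gamma\Rightarrow\Delta$ / $wRv,vRu,\Gamma\Rightarrow\Delta$. Labeled-subformulas of a labeled formula, inductively: $w\Vvdash P$ and $w\Vvdash\bot$ have only themselves; those of $w\Vvdash\neg A$ are itself and all those of $w\Vvdash A$; those of $w\Vvdash A\star B$ ($\star$ a binary connective) are itself and all those of $w\Vvdash A$ and $w\Vvdash B$; those of $w\Vvdash t:A$ are itself and all those of $v\Vvdash A$ for arbitrary labels $v$. *)

theory Defs
  imports "HOL-Library.Multiset"
begin

datatype ('x, 'c) jterm =
    JVar 'x
  | JConst 'c
  | JApp "('x, 'c) jterm" "('x, 'c) jterm"  (infixl "\<cdot>" 75)
  | JSum "('x, 'c) jterm" "('x, 'c) jterm"  (infixl "\<oplus>" 70)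
  | Bang "('x, 'c) jterm"

datatype ('x, 'c, 'p) fm =
    PVar 'p
  | Falsum  ("\<^bold>\<bottom>")
  | Neg "('x, 'c, 'p) fm"  ("\<^bold>\<not> _" [60] 60)
  | Con "('x, 'c, 'p) fm" "('x, 'c, 'p) fm"  (infixr "\<^bold>\<and>" 58)
  | Dis "('x, 'c, 'p) fm" "('x, 'c, 'p) fm"  (infixr "\<^bold>\<or>" 56)
  | Imp "('x, 'c, 'p) fm" "('x, 'c, 'p) fm"  (infixr "\<^bold>\<rightarrow>" 54)
  | Just "('x, 'c) jterm" "('x, 'c, 'p) fm"  (infixr "\<^bold>:" 62)

datatype jlogic = J | J4 | JD | JD4 | JT | LP

definition has_jT :: "jlogic \<Rightarrow> bool" where "has_jT L \<longleftrightarrow> L \<in> {JT, LP}"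
definition has_jD :: "jlogic \<Rightarrow> bool" where "has_jD L \<longleftrightarrow> L \<in> {JD, JD4}"
definition has_j4 :: "jlogic \<Rightarrow> bool" where "has_j4 L \<longleftrightarrow> L \<in> {J4, JD4, LP}"

text \<open>The language of a logic: the operation \<open>!\<close> is available only in the presence of (j4).\<close>

primrec term_of :: "jlogic \<Rightarrow> ('x, 'c) jterm \<Rightarrow> bool" where
  "term_of L (JVar x) \<longleftrightarrow> True"
| "term_of L (JConst c) \<longleftrightarrow> True"
| "term_of L (s \<cdot> t) \<longleftrightarrow> term_of L s \<and> term_of L t"
| "term_of L (s \<oplus> t) \<longleftrightarrow> term_of L s \<and> term_of L t"
| "term_of L (Bang t) \<longleftrightarrow> has_j4 L \<and> term_of L t"

primrec fm_of :: "jlogic \<Rightarrow> ('x, 'c, 'p) fm \<Rightarrow> bool" where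
  "fm_of L (PVar p) \<longleftrightarrow> True"
| "fm_of L \<^bold>\<bottom> \<longleftrightarrow> True"
| "fm_of L (\<^bold>\<not> A) \<longleftrightarrow> fm_of L A"
| "fm_of L (A \<^bold>\<and> B) \<longleftrightarrow> fm_of L A \<and> fm_of L B"
| "fm_of L (A \<^bold>\<or> B) \<longleftrightarrow> fm_of L A \<and> fm_of L B"
| "fm_of L (A \<^bold>\<rightarrow> B) \<longleftrightarrow> fm_of L A \<and> fm_of L B"
| "fm_of L (t \<^bold>: A) \<longleftrightarrow> term_of L t \<and> fm_of L A"

text \<open>Propositional evaluation treats formulas \<open>t \<^bold>: A\<close> as atoms, so that a tautology is
  a substitution instance of a classical propositional tautology.\<close>

primrec peval :: "(('x, 'c, 'p) fm \<Rightarrow> bool) \<Rightarrow> ('x, 'c, 'p) fm \<Rightarrow> bool" where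
  "peval I (PVar p) \<longleftrightarrow> I (PVar p)"
| "peval I \<^bold>\<bottom> \<longleftrightarrow> False"
| "peval I (\<^bold>\<not> A) \<longleftrightarrow> \<not> peval I A"
| "peval I (A \<^bold>\<and> B) \<longleftrightarrow> peval I A \<and> peval I B"
| "peval I (A \<^bold>\<or> B) \<longleftrightarrow> peval I A \<or> peval I B"
| "peval I (A \<^bold>\<rightarrow> B) \<longleftrightarrow> (peval I A \<longrightarrow> peval I B)"
| "peval I (t \<^bold>: A) \<longleftrightarrow> I (t \<^bold>: A)"

definition tautology :: "('x, 'c, 'p) fm \<Rightarrow> bool" where
  "tautology A \<longleftrightarrow> (\<forall>I. peval I A)"

inductive axiom_scheme :: "jlogic \<Rightarrow> ('x, 'c, 'p) fm \<Rightarrow> bool" for L where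
  Taut: "tautology A \<Longrightarrow> axiom_scheme L A"
| SumL: "axiom_scheme L (s \<^bold>: A \<^bold>\<rightarrow> (s \<oplus> t) \<^bold>: A)"
| SumR: "axiom_scheme L (s \<^bold>: A \<^bold>\<rightarrow> (t \<oplus> s) \<^bold>: A)"
| Appl: "axiom_scheme L (s \<^bold>: (A \<^bold>\<rightarrow> B) \<^bold>\<rightarrow> t \<^bold>: A \<^bold>\<rightarrow> (s \<cdot> t) \<^bold>: B)"
| jT: "has_jT L \<Longrightarrow> axiom_scheme L (t \<^bold>: A \<^bold>\<rightarrow> A)"
| jD: "has_jD L \<Longrightarrow> axiom_scheme L (t \<^bold>: \<^bold>\<bottom> \<^bold>\<rightarrow> \<^bold>\<bottom>)"
| j4: "has_j4 L \<Longrightarrow> axiom_scheme L (t \<^bold>: A \<^bold>\<rightarrow> Bang t \<^bold>: t \<^bold>: A)"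

definition axiom_instance :: "jlogic \<Rightarrow> ('x, 'c, 'p) fm \<Rightarrow> bool" where
  "axiom_instance L A \<longleftrightarrow> axiom_scheme L A \<and> fm_of L A"

text \<open>\<open>const_prefix [c\<^sub>n, \<dots>, c\<^sub>1] A\<close> is the formula \<open>c\<^sub>n : \<dots> : c\<^sub>1 : A\<close>.\<close>

definition const_prefix :: "'c list \<Rightarrow> ('x, 'c, 'p) fm \<Rightarrow> ('x, 'c, 'p) fm" where
  "const_prefix cs A = foldr (\<lambda>c B. JConst c \<^bold>: B) cs A"

text \<open>The closure condition only strips prefixes of length at least two, as the formulas of a
  constant specification carry at least one constant.\<close>

definition constant_specification :: "jlogic \<Rightarrow> ('x, 'c, 'p) fm set \<Rightarrow> bool" where
  "constant_specification L CS \<longleftrightarrow>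
    (if has_j4 L
     then CS \<subseteq> {JConst c \<^bold>: A | c A. axiom_instance L A}
     else CS \<subseteq> {const_prefix cs A | cs A. cs \<noteq> [] \<and> axiom_instance L A} \<and>
       (\<forall>c cs A. cs \<noteq> [] \<and> axiom_instance L A \<and> const_prefix (c # cs) A \<in> CS
          \<longrightarrow> const_prefix cs A \<in> CS))"

type_synonym label = nat

datatype ('x, 'c, 'p) lexpr =
    LFm label "('x, 'c, 'p) fm"  (infix "\<Turnstile>" 52)
  | Rel label label
  | Evi label "('x, 'c) jterm" "('x, 'c, 'p) fm"

datatype ('x, 'c, 'p) sequent =
  Sequent (ant: "('x, 'c, 'p) lexpr multiset") (suc: "('x, 'c, 'p) lexpr multiset")
    (infix "\<turnstile>" 51)

definition exprs :: "('x, 'c, 'p) sequent \<Rightarrow> ('x, 'c, 'p) lexpr set" where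
  "exprs S = set_mset (ant S) \<union> set_mset (suc S)"

definition labeled_formulas :: "('x, 'c, 'p) sequent \<Rightarrow> ('x, 'c, 'p) lexpr set" where
  "labeled_formulas S = {w \<Turnstile> A | w A. (w \<Turnstile> A) \<in> exprs S}"

primrec labels_of :: "('x, 'c, 'p) lexpr \<Rightarrow> label set" where
  "labels_of (w \<Turnstile> A) = {w}"
| "labels_of (Rel w v) = {w, v}"
| "labels_of (Evi w t A) = {w}"

definition labels :: "('x, 'c, 'p) sequent \<Rightarrow> label set" where
  "labels S = (\<Union>e \<in> exprs S. labels_of e)"

primrec lexpr_of :: "jlogic \<Rightarrow> ('x, 'c, 'p) lexpr \<Rightarrow> bool" where
  "lexpr_of L (w \<Turnstile> A) \<longleftrightarrow> fm_of L A"
| "lexpr_of L (Rel w v) \<longleftrightarrow> True"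
| "lexpr_of L (Evi w t A) \<longleftrightarrow> term_of L t \<and> fm_of L A"

definition sequent_of :: "jlogic \<Rightarrow> ('x, 'c, 'p) sequent \<Rightarrow> bool" where
  "sequent_of L S \<longleftrightarrow> (\<forall>e \<in> exprs S. lexpr_of L e)"

text \<open>\<open>G3_rule L CS Ps S\<close>: the sequent \<open>S\<close> is the conclusion of a rule instance with list of
  premises \<open>Ps\<close>; initial sequents are the instances without premises.\<close>

inductive G3_rule ::
  "jlogic \<Rightarrow> ('x, 'c, 'p) fm set \<Rightarrow> ('x, 'c, 'p) sequent list \<Rightarrow> ('x, 'c, 'p) sequent \<Rightarrow> bool"
  for L CS where
  AxP: "G3_rule L CS [] ({#w \<Turnstile> PVar p#} + \<Gamma> \<turnstile> \<Delta> + {#w \<Turnstile> PVar p#})"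
| AxBot: "G3_rule L CS [] ({#w \<Turnstile> \<^bold>\<bottom>#} + \<Gamma> \<turnstile> \<Delta>)"
| AxR: "G3_rule L CS [] ({#Rel w v#} + \<Gamma> \<turnstile> \<Delta> + {#Rel w v#})"
| AxE: "G3_rule L CS [] ({#Evi w t A#} + \<Gamma> \<turnstile> \<Delta> + {#Evi w t A#})"
| LNeg: "G3_rule L CS [\<Gamma> \<turnstile> \<Delta> + {#w \<Turnstile> A#}] ({#w \<Turnstile> \<^bold>\<not> A#} + \<Gamma> \<turnstile> \<Delta>)"
| RNeg: "G3_rule L CS [{#w \<Turnstile> A#} + \<Gamma> \<turnstile> \<Delta>] (\<Gamma> \<turnstile> \<Delta> + {#w \<Turnstile> \<^bold>\<not> A#})"
| LCon: "G3_rule L CS [{#w \<Turnstile> A, w \<Turnstile> B#} + \<Gamma> \<turnstile> \<Delta>] ({#w \<Turnstile> A \<^bold>\<and> B#} + \<Gamma> \<turnstile> \<Delta>)"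
| RCon: "G3_rule L CS [\<Gamma> \<turnstile> \<Delta> + {#w \<Turnstile> A#}, \<Gamma> \<turnstile> \<Delta> + {#w \<Turnstile> B#}] (\<Gamma> \<turnstile> \<Delta> + {#w \<Turnstile> A \<^bold>\<and> B#})"
| LDis: "G3_rule L CS [{#w \<Turnstile> A#} + \<Gamma> \<turnstile> \<Delta>, {#w \<Turnstile> B#} + \<Gamma> \<turnstile> \<Delta>] ({#w \<Turnstile> A \<^bold>\<or> B#} + \<Gamma> \<turnstile> \<Delta>)"
| RDis: "G3_rule L CS [\<Gamma> \<turnstile> \<Delta> + {#w \<Turnstile> A, w \<Turnstile> B#}] (\<Gamma> \<turnstile> \<Delta> + {#w \<Turnstile> A \<^bold>\<or> B#})"
| LImp: "G3_rule L CS [\<Gamma> \<turnstile> \<Delta> + {#w \<Turnstile> A#}, {#w \<Turnstile> B#} + \<Gamma> \<turnstile> \<Delta>] ({#w \<Turnstile> A \<^bold>\<rightarrow> B#} + \<Gamma> \<turnstile> \<Delta>)"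
| RImp: "G3_rule L CS [{#w \<Turnstile> A#} + \<Gamma> \<turnstile> \<Delta> + {#w \<Turnstile> B#}] (\<Gamma> \<turnstile> \<Delta> + {#w \<Turnstile> A \<^bold>\<rightarrow> B#})"
| LJust: "G3_rule L CS
    [{#v \<Turnstile> A, w \<Turnstile> t \<^bold>: A, Rel w v#} + \<Gamma> \<turnstile> \<Delta>] ({#w \<Turnstile> t \<^bold>: A, Rel w v#} + \<Gamma> \<turnstile> \<Delta>)"
| RJust: "v \<notin> labels ({#Evi w t A#} + \<Gamma> \<turnstile> \<Delta> + {#w \<Turnstile> t \<^bold>: A#}) \<Longrightarrow> G3_rule L CS
    [{#Rel w v, Evi w t A#} + \<Gamma> \<turnstile> \<Delta> + {#v \<Turnstile> A#}]
    ({#Evi w t A#} + \<Gamma> \<turnstile> \<Delta> + {#w \<Turnstile> t \<^bold>: A#})"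
| E: "G3_rule L CS
    [{#Evi w t A, w \<Turnstile> t \<^bold>: A#} + \<Gamma> \<turnstile> \<Delta>] ({#w \<Turnstile> t \<^bold>: A#} + \<Gamma> \<turnstile> \<Delta>)"
| ElSum: "G3_rule L CS
    [{#Evi w (s \<oplus> t) A, Evi w t A#} + \<Gamma> \<turnstile> \<Delta>] ({#Evi w t A#} + \<Gamma> \<turnstile> \<Delta>)"
| ErSum: "G3_rule L CS
    [{#Evi w (t \<oplus> s) A, Evi w t A#} + \<Gamma> \<turnstile> \<Delta>] ({#Evi w t A#} + \<Gamma> \<turnstile> \<Delta>)"
| EApp: "G3_rule L CS
    [{#Evi w (s \<cdot> t) B, Evi w s (A \<^bold>\<rightarrow> B), Evi w t A#} + \<Gamma> \<turnstile> \<Delta>]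
    ({#Evi w s (A \<^bold>\<rightarrow> B), Evi w t A#} + \<Gamma> \<turnstile> \<Delta>)"
| AN: "JConst c \<^bold>: F \<in> CS \<Longrightarrow> G3_rule L CS [{#Evi w (JConst c) F#} + \<Gamma> \<turnstile> \<Delta>] (\<Gamma> \<turnstile> \<Delta>)"
| Ref: "has_jT L \<Longrightarrow> G3_rule L CS [{#Rel w w#} + \<Gamma> \<turnstile> \<Delta>] (\<Gamma> \<turnstile> \<Delta>)"
| Ser: "has_jD L \<Longrightarrow> v \<notin> labels (\<Gamma> \<turnstile> \<Delta>) \<Longrightarrow>
    G3_rule L CS [{#Rel w v#} + \<Gamma> \<turnstile> \<Delta>] (\<Gamma> \<turnstile> \<Delta>)"
| EBang: "has_j4 L \<Longrightarrow> G3_rule L CS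
    [{#Evi w (Bang t) (t \<^bold>: A), Evi w t A#} + \<Gamma> \<turnstile> \<Delta>] ({#Evi w t A#} + \<Gamma> \<turnstile> \<Delta>)"
| Mon: "has_j4 L \<Longrightarrow> G3_rule L CS
    [{#Evi v t A, Evi w t A, Rel w v#} + \<Gamma> \<turnstile> \<Delta>] ({#Evi w t A, Rel w v#} + \<Gamma> \<turnstile> \<Delta>)"
| Trans: "has_j4 L \<Longrightarrow> G3_rule L CS
    [{#Rel w u, Rel w v, Rel v u#} + \<Gamma> \<turnstile> \<Delta>] ({#Rel w v, Rel v u#} + \<Gamma> \<turnstile> \<Delta>)"

text \<open>Finite trees of sequents, with the endsequent at the root; \<open>nodes d\<close> is the set of all
  sequents occurring in \<open>d\<close>.\<close>

datatype (nodes: 's) dtree = Node (endsequent: 's) (subtrees: "'s dtree list")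

inductive G3_derivation ::
  "jlogic \<Rightarrow> ('x, 'c, 'p) fm set \<Rightarrow> ('x, 'c, 'p) sequent dtree \<Rightarrow> bool"
  for L CS where
  "G3_rule L CS (map endsequent ds) S \<Longrightarrow> sequent_of L S \<Longrightarrow>
    (\<forall>d \<in> set ds. G3_derivation L CS d) \<Longrightarrow> G3_derivation L CS (Node S ds)"

fun labeled_subformulas :: "label \<Rightarrow> ('x, 'c, 'p) fm \<Rightarrow> ('x, 'c, 'p) lexpr set" where
  "labeled_subformulas w (PVar p) = {w \<Turnstile> PVar p}"
| "labeled_subformulas w \<^bold>\<bottom> = {w \<Turnstile> \<^bold>\<bottom>}"
| "labeled_subformulas w (\<^bold>\<not> A) = {w \<Turnstile> \<^bold>\<not> A} \<union> labeled_subformulas w A"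
| "labeled_subformulas w (A \<^bold>\<and> B) =
    {w \<Turnstile> A \<^bold>\<and> B} \<union> labeled_subformulas w A \<union> labeled_subformulas w B"
| "labeled_subformulas w (A \<^bold>\<or> B) =
    {w \<Turnstile> A \<^bold>\<or> B} \<union> labeled_subformulas w A \<union> labeled_subformulas w B"
| "labeled_subformulas w (A \<^bold>\<rightarrow> B) =
    {w \<Turnstile> A \<^bold>\<rightarrow> B} \<union> labeled_subformulas w A \<union> labeled_subformulas w B"
| "labeled_subformulas w (t \<^bold>: A) = {w \<Turnstile> t \<^bold>: A} \<union> (\<Union>v. labeled_subformulas v A)"

end

theory Submission
  imports Defs
begin

text \<open>
  Read from the conclusion to the premises, every rule is local: a labeled formula in a premise
  either occurs in the conclusion already, or arises from one there by removing its outermost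
  connective or term. The rules for relational and evidence atoms add atoms only; in particular,
  the rule for the constant specification puts \<open>F\<close> into an evidence atom \<open>wE(c,F)\<close>, from which no
  rule recovers it as a labeled formula. Labeled-subformulas change the label at \<open>t \<^bold>: A\<close>
  because the two rules for it pass from \<open>w \<Turnstile> t \<^bold>: A\<close> to \<open>v \<Turnstile> A\<close>, where \<open>v\<close> may be a fresh label.

  So \<open>G3_rule_subformula\<close> gives the claim for one step, and since being a labeled-subformula is
  transitive (\<open>labeled_subformulas_trans\<close>), the steps compose along each branch of the derivation.
\<close>

definition subformula_closure :: "('x, 'c, 'p) sequent \<Rightarrow> ('x, 'c, 'p) lexpr set" where
  "subformula_closure S =
    {e. \<exists>w A. (w \<Turnstile> A) \<in> labeled_formulas S \<and> e \<in> labeled_subformulas w A}"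

lemma labeled_subformulas_refl: "(w \<Turnstile> A) \<in> labeled_subformulas w A"
  by (cases A) auto

text \<open>In the justification case the formula may lie below any label \<open>u\<close>, so the induction
  hypothesis is needed at \<open>u\<close> instead of \<open>w\<close>.\<close>

lemma labeled_subformulas_trans:
  "(v \<Turnstile> B) \<in> labeled_subformulas w A \<Longrightarrow> labeled_subformulas v B \<subseteq> labeled_subformulas w A"
proof (induction A arbitrary: w)
  case (Just t A)
  show ?case
  proof (cases "v = w \<and> B = t \<^bold>: A")
    case False
    then obtain u where "(v \<Turnstile> B) \<in> labeled_subformulas u A"
      using Just.prems by auto
    then have "labeled_subformulas v B \<subseteq> labeled_subformulas u A"
      by (rule Just.IH)
    then show ?thesis by auto
  qed simp
qed fastforce+

lemma labeled_formulas_subset_closure: "labeled_formulas S \<subseteq> subformula_closure S"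
  using labeled_subformulas_refl
  by (fastforce simp: subformula_closure_def labeled_formulas_def)

lemma subformula_closure_least:
  assumes "labeled_formulas P \<subseteq> subformula_closure S"
  shows "subformula_closure P \<subseteq> subformula_closure S"
  using assms labeled_subformulas_trans unfolding subformula_closure_def by blast

text \<open>Side formulas, and principal formulas repeated in the premise, occur in the conclusion; any
  other labeled formula of a premise is an immediate subformula of the principal formula. The first
  alternative of the disjunction in the proof is the special case of reflexivity.\<close>

lemma G3_rule_subformula:
  assumes "G3_rule L CS Ps S" and "P \<in> set Ps"
  shows "labeled_formulas P \<subseteq> subformula_closure S"
proof
  fix e assume "e \<in> labeled_formulas P"
  then obtain v B where e: "e = (v \<Turnstile> B)" and "(v \<Turnstile> B) \<in> exprs P"
    unfolding labeled_formulas_def by blast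
  with assms have "(v \<Turnstile> B) \<in> exprs S \<or>
      (\<exists>w A. (w \<Turnstile> A) \<in> exprs S \<and> (v \<Turnstile> B) \<in> labeled_subformulas w A)"
    by (cases rule: G3_rule.cases)
      (simp_all add: exprs_def, (fastforce intro: labeled_subformulas_refl)+)
  then show "e \<in> subformula_closure S"
    using labeled_subformulas_refl unfolding e subformula_closure_def labeled_formulas_def by blast
qed

lemma G3_derivation_subformula:
  assumes "G3_derivation L CS d"
  shows "\<forall>S \<in> nodes d. labeled_formulas S \<subseteq> subformula_closure (endsequent d)"
  using assms
proof (induction rule: G3_derivation.induct)
  case (1 ds S)
  show ?case
  proof
    fix T assume "T \<in> nodes (Node S ds)"
    then consider "T = S" | d where "d \<in> set ds" "T \<in> nodes d" by auto
    then show "labeled_formulas T \<subseteq> subformula_closure (endsequent (Node S ds))"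
    proof cases
      case 1
      then show ?thesis by (simp add: labeled_formulas_subset_closure)
    next
      case 2
      then have "labeled_formulas T \<subseteq> subformula_closure (endsequent d)"
        using "1.IH" by blast
      also have "\<dots> \<subseteq> subformula_closure S"
        using 1 2 by (intro subformula_closure_least G3_rule_subformula) auto
      finally show ?thesis by simp
    qed
  qed
qed

theorem proposition6p1:
  fixes L :: jlogic
    and CS :: "('x, 'c, 'p) fm set"
    and d :: "('x, 'c, 'p) sequent dtree"
  assumes "constant_specification L CS"
    and "G3_derivation L CS d"
  shows "\<forall>S \<in> nodes d. \<forall>e \<in> labeled_formulas S.
    \<exists>w A. (w \<Turnstile> A) \<in> labeled_formulas (endsequent d) \<and> e \<in> labeled_subformulas w A"
  using G3_derivation_subformula[OF assms(2)] unfolding subformula_closure_def by blast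

end
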